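(* Let $k\geq 1$. Let $f$ be a $2\pi$-periodic function, Lebesgue integrable over $(-\pi,\pi)$, whose Fourier series has zero constant term, and let $x$ be a fixed real number. Let $C_n(x)$ ($n\ge 1$) be the $n$th term of the Fourier series of $f$ at $x$, let $\phi(t)=\frac12\{f(x+t)+f(x-t)\}$, and let $\phi_1(t)=\frac1t\int_0^t\phi(u)\,du$. Assume that $\phi_1$ is of bounded variation on $(0,\pi)$. Let $(p_n)_{n\ge 0}$ be a sequence of positive numbers with $P_n=\sum_{v=0}^n p_v\to\infty$ and $P_n=O(np_n)$ as $n\to\infty$, and let $X_n=\sum_{v=1}^n \frac{p_v}{P_v}$ for $n\ge 1$. Let $(\lambda_n)_{n\ge 1}$ be a sequence with $\lambda_n\to 0$ as $n\to\infty$. Suppose that there exist a sequence $\delta=(\delta_n)$ of positive numbers and a sequence of numbers $(A_n)$ which is $\delta$-quasi-monotone, such that $\sum_{n} nX_n\delta_n<\infty$, the series $\sum_n A_nX_n$ is convergent, and $|\lambda_n-\lambda_{n+1}|\leq |A_n|$ for all $n$. Let $A=(a_{nv})_{n,v\ge 0}$ be a positive normal matrix such that (i) $\bar a_{n0}=1$ for $n=0,1,\dots$; (ii) $a_{n-1,v}\geq a_{nv}$ for $n\geq v+1$; (iii) $a_{nn}=O\left(\frac{p_n}{P_n}\right)$; (iv) $\hat a_{n,v+1}=O\left(v\,|\bar\Delta a_{nv}|\right)$, uniformly for $1\le v\le n-1$. Then the series $\sum_{n=1}^\infty C_n(x)\lambda_n$ is summable $|A,p_n|_k$.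
   Context: **Fourier series.** For a $2\pi$-periodic function $f$ integrable over $(-\pi,\pi)$ with $\int_{-\pi}^{\pi}f(t)\,dt=0$, its Fourier series is $f(t)\sim\sum_{n=1}^\infty C_n(t)$, where $$C_n(t)=\left(\frac1\pi\int_{-\pi}^{\pi}f(u)\cos(nu)\,du\right)\cos nt+\left(\frac1\pi\int_{-\pi}^{\pi}f(u)\sin(nu)\,du\right)\sin nt .$$ **Quasi-monotone sequences.** Given a sequence $\delta=(\delta_n)$ of positive numbers, a sequence $(d_n)$ is $\delta$-quasi-monotone if $d_n\to 0$, $d_n>0$ ultimately (for all sufficiently large $n$), and $d_n-d_{n+1}\geq-\delta_n$ for all $n$. **Matrices.** A normal matrix $A=(a_{nv})_{n,v\ge0}$ is a lower triangular matrix ($a_{nv}=0$ for $v>n$) with nonzero diagonal entries. It is positive if $a_{nv}\ge 0$ for all $n,v$ (so the diagonal entries are positive). Associated with $A$ are $$\bar a_{nv}=\sum_{i=v}^n a_{ni}\quad (n,v=0,1,\dots),\qquad \bar\Delta a_{nv}=a_{nv}-a_{n-1,v},\quad a_{-1,0}=0,$$ $$\hat a_{00}=\bar a_{00}=a_{00},\qquad \hat a_{nv}=\bar a_{nv}-\bar a_{n-1,v}\quad (n=1,2,\dots).$$ **Summability.** For a sequence $s=(s_n)_{n\ge0}$, put $A_n(s)=\sum_{v=0}^n a_{nv}s_v$ for $n=0,1,\dots$ (the transform $A_n(s)$ is not to be confused with the numerical sequence $(A_n)$ in the claim). Let $k\geq1$ and let $(p_n)$ be a sequence of positive numbers with $P_n=\sum_{v=0}^n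 p_v\to\infty$. An infinite series with partial sums $(s_n)$ is said to be summable $|A,p_n|_k$ if $$\sum_{n=1}^\infty\left(\frac{P_n}{p_n}\right)^{k-1}|A_n(s)-A_{n-1}(s)|^k<\infty .$$ For a series $\sum_{n\ge1}c_n$ the term of index $0$ is taken to be $0$, so $s_0=0$ and $s_n=\sum_{v=1}^n c_v$. *)

theory Defs
  imports "HOL-Analysis.Analysis" "HOL-Library.Landau_Symbols"
begin

definition fourier_term :: "(real \<Rightarrow> real) \<Rightarrow> nat \<Rightarrow> real \<Rightarrow> real" where
  "fourier_term f n t =
     (1 / pi * (LINT u:{-pi..pi}|lebesgue. f u * cos (real n * u))) * cos (real n * t)
   + (1 / pi * (LINT u:{-pi..pi}|lebesgue. f u * sin (real n * u))) * sin (real n * t)"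

definition phi :: "(real \<Rightarrow> real) \<Rightarrow> real \<Rightarrow> real \<Rightarrow> real" where
  "phi f x t = 1 / 2 * (f (x + t) + f (x - t))"

text \<open>Only meaningful (and only used) for \<open>t > 0\<close>.\<close>

definition phi1 :: "(real \<Rightarrow> real) \<Rightarrow> real \<Rightarrow> real \<Rightarrow> real" where
  "phi1 f x t = 1 / t * (LINT u:{0..t}|lebesgue. phi f x u)"

text \<open>Bounded variation on an arbitrary set of reals, such as an open interval: the variation sums
  over all finite nondecreasing families of points of the set have a common bound.\<close>

definition bounded_variation_on :: "(real \<Rightarrow> real) \<Rightarrow> real set \<Rightarrow> bool" where
  "bounded_variation_on g S \<longleftrightarrow>
     (\<exists>M. \<forall>(m::nat) (t :: nat \<Rightarrow> real).
        (\<forall>i\<le>m. t i \<in> S) \<and> (\<forall>i<m. t i \<le> t (Suc i)) \<longrightarrow>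
        (\<Sum>i<m. \<bar>g (t (Suc i)) - g (t i)\<bar>) \<le> M)"

text \<open>The sequences \<open>\<delta>\<close> and \<open>d\<close> are indexed from 1; their values at 0 are irrelevant.\<close>

definition quasi_monotone :: "(nat \<Rightarrow> real) \<Rightarrow> (nat \<Rightarrow> real) \<Rightarrow> bool" where
  "quasi_monotone \<delta> d \<longleftrightarrow>
     d \<longlonglongrightarrow> 0 \<and> (\<forall>\<^sub>F n in sequentially. d n > 0) \<and> (\<forall>n\<ge>1. d n - d (Suc n) \<ge> - \<delta> n)"

definition normal_matrix :: "(nat \<Rightarrow> nat \<Rightarrow> real) \<Rightarrow> bool" where
  "normal_matrix a \<longleftrightarrow> (\<forall>n v. v > n \<longrightarrow> a n v = 0) \<and> (\<forall>n. a n n \<noteq> 0)"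

definition positive_matrix :: "(nat \<Rightarrow> nat \<Rightarrow> real) \<Rightarrow> bool" where
  "positive_matrix a \<longleftrightarrow> (\<forall>n v. a n v \<ge> 0)"

definition bar_mat :: "(nat \<Rightarrow> nat \<Rightarrow> real) \<Rightarrow> nat \<Rightarrow> nat \<Rightarrow> real" where
  "bar_mat a n v = (\<Sum>i=v..n. a n i)"

text \<open>In the next two definitions, entries with row index \<open>-1\<close> are read as 0.\<close>

definition bar_Delta :: "(nat \<Rightarrow> nat \<Rightarrow> real) \<Rightarrow> nat \<Rightarrow> nat \<Rightarrow> real" where
  "bar_Delta a n v = (if n = 0 then a 0 v else a n v - a (n - 1) v)"

definition hat_mat :: "(nat \<Rightarrow> nat \<Rightarrow> real) \<Rightarrow> nat \<Rightarrow> nat \<Rightarrow> real" where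
  "hat_mat a n v = (if n = 0 then bar_mat a 0 v else bar_mat a n v - bar_mat a (n - 1) v)"

definition mat_transform :: "(nat \<Rightarrow> nat \<Rightarrow> real) \<Rightarrow> (nat \<Rightarrow> real) \<Rightarrow> nat \<Rightarrow> real" where
  "mat_transform a s n = (\<Sum>v=0..n. a n v * s v)"

definition P_sum :: "(nat \<Rightarrow> real) \<Rightarrow> nat \<Rightarrow> real" where
  "P_sum p n = (\<Sum>v=0..n. p v)"

definition X_sum :: "(nat \<Rightarrow> real) \<Rightarrow> nat \<Rightarrow> real" where
  "X_sum p n = (\<Sum>v=1..n. p v / P_sum p v)"

text \<open>Summability \<open>|A, p\<^sub>n|\<^sub>k\<close> of the series \<open>\<Sum>n\<ge>1. c n\<close>; the value \<open>c 0\<close> is not used, so that the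
  partial sums start with \<open>s\<^sub>0 = 0\<close>. The index \<open>n \<ge> 1\<close> of the defining series is written \<open>Suc n\<close>.\<close>

definition abs_summable_matrix ::
    "(nat \<Rightarrow> nat \<Rightarrow> real) \<Rightarrow> (nat \<Rightarrow> real) \<Rightarrow> real \<Rightarrow> (nat \<Rightarrow> real) \<Rightarrow> bool" where
  "abs_summable_matrix a p k c \<longleftrightarrow>
     (let s = (\<lambda>n. \<Sum>v=1..n. c v) in
      summable (\<lambda>n. (P_sum p (Suc n) / p (Suc n)) powr (k - 1)
        * \<bar>mat_transform a s (Suc n) - mat_transform a s n\<bar> powr k))"

end

theory Submission
  imports Defs
begin

text \<open>
  Two facts of different nature are combined.

  The Fourier side. With \<open>\<Phi> t = t * phi1 f x t\<close> an indefinite integral of \<open>phi f x\<close>, the sum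
  \<open>\<Sum>v\<le>n. v * C\<^sub>v(x)\<close> is \<open>2/\<pi>\<close> times the integral over \<open>(0,\<pi>)\<close> of \<open>phi f x\<close> against the kernel
  \<open>K\<^sub>n t = \<Sum>v\<le>n. v * cos (v * t)\<close>. Writing \<open>d\<Phi> = t d\<phi>\<^sub>1 + \<phi>\<^sub>1 dt\<close>, the first part is at most the supremum
  of \<open>\<bar>t * K\<^sub>n t\<bar>\<close> times the variation of \<open>\<phi>\<^sub>1\<close>. The second part is integrated by parts against
  \<open>D\<^sub>n t = \<Sum>v\<le>n. sin (v * t)\<close>, a primitive of \<open>K\<^sub>n\<close>. Both \<open>D\<^sub>n\<close> and \<open>t * K\<^sub>n t\<close> are \<open>O(n)\<close> uniformly
  on \<open>[0,\<pi>]\<close>, so the (C,1) means of \<open>n * C\<^sub>n(x)\<close> are bounded (\<open>fourier_term_means_bounded\<close>). The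
  Stieltjes integrals appear only as sums over uniform partitions whose mesh tends to 0
  (\<open>integral_product_bound_of_mean_variation\<close>).

  The matrix side. The differences \<open>T\<^sub>n\<close> of the transform equal \<open>\<Sum>v\<le>n. hat_mat a n v * C\<^sub>v(x) * lam v\<close>.
  Summation by parts against the bounded means gives \<open>\<bar>T\<^sub>n\<bar> \<le> M * E\<^sub>n\<close>, where
  \<open>E\<^sub>n = transform_majorant a lam n\<close>. Rows summing to 1 and decreasing columns control \<open>E\<^sub>n\<close> in
  two ways. Along row \<open>n\<close> the decreases \<open>a (n-1) v - a n v\<close> add up to \<open>a n n\<close>, and \<open>hat_mat a n (v+1)\<close>, a
  partial sum of them, is at most \<open>a n n\<close>, whence
  \<open>E\<^sub>n = O(a n n) = O(p n / P_sum p n)\<close>. Down a column, the coefficients telescope, whence \<open>\<Sum>n. E\<^sub>n\<close>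
  is finite as soon as \<open>\<Sum>v. a v v * \<bar>lam v\<bar>\<close>, \<open>\<Sum>v. \<bar>lam v - lam (v+1)\<bar>\<close> and \<open>\<Sum>v. \<bar>lam v\<bar> / v\<close> are. The exponent
  then costs nothing: \<open>(P/p)\<^sup>k\<^sup>-\<^sup>1 * \<bar>T\<^sub>n\<bar>\<^sup>k = (P/p * \<bar>T\<^sub>n\<bar>)\<^sup>k\<^sup>-\<^sup>1 * \<bar>T\<^sub>n\<bar>\<close> is a bounded factor times a
  summable one (\<open>abs_summable_matrix_of_bounded_means\<close>).

  The three series converge because \<open>A n\<close> is ultimately positive, so \<open>\<Sum>n. \<bar>A n\<bar> * X_sum p n\<close> converges.
  It dominates \<open>\<Sum>n. \<bar>A n\<bar>\<close>, hence the series of differences of \<open>lam\<close>. Moreover, by \<open>\<bar>lam v\<bar> \<le> \<Sum>u\<ge>v. \<bar>A u\<bar>\<close> and an interchange of summation it dominates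
  \<open>\<Sum>v. p v / P_sum p v * \<bar>lam v\<bar>\<close>, and both \<open>a v v\<close> and \<open>1 / v\<close> are \<open>O(p v / P_sum p v)\<close>.
\<close>

section \<open>Triangular matrices with decreasing columns\<close>

text \<open>Rows \<open>n - 1\<close> and \<open>n\<close> both have total 1, so what the entries up to \<open>v\<close> lose from one row to the next is
  gained by the entries beyond \<open>v\<close>. In this form \<open>hat_mat\<close> is visibly nonnegative when the columns
  decrease, and it telescopes in \<open>n\<close>.\<close>

lemma hat_mat_eq_row_decrease:
  assumes rows: "\<And>n. bar_mat a n 0 = 1" and "v < n"
  shows "hat_mat a n (Suc v) = (\<Sum>i=0..v. a (n - 1) i - a n i)"
proof -
  have "bar_mat a m (Suc v) = 1 - (\<Sum>i=0..v. a m i)" if "v \<le> m" for m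
  proof -
    have "(\<Sum>i=0..m. a m i) = (\<Sum>i=0..v. a m i) + (\<Sum>i=Suc v..m. a m i)"
      using that by (metis Suc_eq_plus1 le0 le_add_diff_inverse sum.ub_add_nat)
    then show ?thesis using rows[of m] by (simp add: bar_mat_def)
  qed
  from this[of n] this[of "n - 1"] \<open>v < n\<close> show ?thesis
    by (simp add: hat_mat_def sum_subtractf)
qed

lemma sum_row_decrease:
  assumes rows: "\<And>n. bar_mat a n 0 = 1" and "0 < n"
  shows "(\<Sum>i<n. a (n - 1) i - a n i) = a n n"
proof -
  obtain m where m: "n = Suc m" using \<open>0 < n\<close> by (cases n) auto
  show ?thesis using rows[of n] rows[of m] 
    by (simp add: m bar_mat_def sum_subtractf lessThan_Suc_atMost atLeast0AtMost)
qed

text \<open>Row \<open>n\<close> of the decreases has nonnegative terms and total \<open>a n n\<close>, and \<open>hat_mat a n (Suc v)\<close> is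
  a partial sum of it.\<close>

lemma hat_mat_bounds:
  assumes rows: "\<And>n. bar_mat a n 0 = 1"
    and decr: "\<And>n v. v + 1 \<le> n \<Longrightarrow> a n v \<le> a (n - 1) v"
    and "v < n"
  shows "0 \<le> hat_mat a n (Suc v)" "hat_mat a n (Suc v) \<le> a n n"
proof -
  have pos: "0 \<le> a (n - 1) i - a n i" if "i < n" for i
    using decr[of i n] that by simp
  show "0 \<le> hat_mat a n (Suc v)"
    unfolding hat_mat_eq_row_decrease[OF rows \<open>v < n\<close>]
    using pos \<open>v < n\<close> by (intro sum_nonneg) auto
  have "(\<Sum>i=0..v. a (n - 1) i - a n i) \<le> (\<Sum>i<n. a (n - 1) i - a n i)"
    using pos \<open>v < n\<close> by (intro sum_mono2) auto
  then show "hat_mat a n (Suc v) \<le> a n n"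
    using sum_row_decrease[where a=a and n=n, OF rows] \<open>v < n\<close>
      hat_mat_eq_row_decrease[of a v n, OF rows] by simp
qed

lemma sum_column_decrease:
  fixes a :: "nat \<Rightarrow> nat \<Rightarrow> real"
  assumes "v \<le> N"
  shows "(\<Sum>n=Suc v..N. a (n - 1) i - a n i) = a v i - a N i"
  using assms by (induction N rule: dec_induct) auto

lemma hat_mat_diag:
  assumes "\<And>n v. n < v \<Longrightarrow> a n v = 0" 
  shows "hat_mat a n n = a n n"
  using assms by (cases n) (simp_all add: hat_mat_def bar_mat_def)

lemma hat_mat_diff_column:
  assumes "v < n" and "0 < v"
  shows "hat_mat a n v - hat_mat a n (Suc v) = a n v - a (n - 1) v"
  using assms by (auto simp: hat_mat_def bar_mat_def sum.atLeast_Suc_atMost)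

lemma mat_transform_partial_sums:
  "mat_transform a (\<lambda>n. \<Sum>v=1..n. c v) n = (\<Sum>u=1..n. bar_mat a n u * c u)"
proof -
  have "mat_transform a (\<lambda>n. \<Sum>v=1..n. c v) n = (\<Sum>v\<in>{0..n}. \<Sum>u\<in>{u\<in>{1..n}. u \<le> v}. a n v * c u)"
    unfolding mat_transform_def sum_distrib_left
    by (intro sum.cong refl) auto
  also have "\<dots> = (\<Sum>u\<in>{1..n}. \<Sum>v\<in>{v\<in>{0..n}. u \<le> v}. a n v * c u)"
    by (rule sum.swap_restrict) auto
  also have "\<dots> = (\<Sum>u=1..n. bar_mat a n u * c u)"
    unfolding bar_mat_def sum_distrib_right
    by (intro sum.cong refl) auto
  finally show ?thesis .
qed

text \<open>The entry \<open>bar_mat a (n - 1) n\<close> is an empty sum, so the shorter transform can be extended to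
  \<open>n\<close> terms.\<close>

lemma mat_transform_diff:
  assumes "0 < n"
  shows "mat_transform a (\<lambda>n. \<Sum>v=1..n. c v) n - mat_transform a (\<lambda>n. \<Sum>v=1..n. c v) (n - 1)
    = (\<Sum>v=1..n. hat_mat a n v * c v)"
proof -
  have "(\<Sum>u=1..n - 1. bar_mat a (n - 1) u * c u) = (\<Sum>u=1..n. bar_mat a (n - 1) u * c u)"
    using assms by (intro sum.mono_neutral_left) (auto simp: bar_mat_def)
  then show ?thesis
    using assms unfolding mat_transform_partial_sums
    by (simp add: hat_mat_def sum_subtractf left_diff_distrib)
qed

text \<open>Abel summation after splitting off the factor \<open>v\<close>, which is what makes the (C,1) means of \<open>v * c v\<close>
  appear.\<close>

lemma sum_by_parts_weighted:
  fixes b c :: "nat \<Rightarrow> real"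
  assumes "1 \<le> n"
  shows "(\<Sum>v=1..n. b v * c v)
    = (\<Sum>v=1..<n. (b v / v - b (Suc v) / Suc v) * (\<Sum>u=1..v. u * c u)) + b n / n * (\<Sum>u=1..n. u * c u)"
  using assms
proof (induction n rule: dec_induct)
  case base
  then show ?case by simp
next
  case (step n)
  define S where "S v = (\<Sum>u=1..v. u * c u)" for v
  have S: "S (Suc n) = S n + Suc n * c (Suc n)" by (simp add: S_def)
  have "(\<Sum>v=1..Suc n. b v * c v) = (\<Sum>v=1..<n. (b v / v - b (Suc v) / Suc v) * S v) + b n / n * S n
      + b (Suc n) / Suc n * (S (Suc n) - S n)"
    using step by (simp add: S S_def del: of_nat_Suc)
  also have "\<dots> = (\<Sum>v=1..<Suc n. (b v / v - b (Suc v) / Suc v) * S v) + b (Suc n) / Suc n * S (Suc n)"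
    using step by (simp add: left_diff_distrib right_diff_distrib)
  finally show ?case by (simp add: S_def)
qed

text \<open>Interchanging the summations replaces the sum over a triangle by column sums.\<close>

lemma sum_triangle_le:
  fixes g :: "nat \<Rightarrow> nat \<Rightarrow> real"
  assumes col: "\<And>v. 1 \<le> v \<Longrightarrow> v \<le> N \<Longrightarrow> (\<Sum>n=Suc v..N. g n v) \<le> B v"
    and u: "\<And>v. 0 \<le> u v"
  shows "(\<Sum>n=1..N. \<Sum>v=1..<n. g n v * u v) \<le> (\<Sum>v=1..N. B v * u v)"
proof -
  have "(\<Sum>n=1..N. \<Sum>v=1..<n. g n v * u v) = (\<Sum>n\<in>{1..N}. \<Sum>v\<in>{v\<in>{1..N}. v < n}. g n v * u v)"
    by (intro sum.cong refl) auto
  also have "\<dots> = (\<Sum>v\<in>{1..N}. \<Sum>n\<in>{n\<in>{1..N}. v < n}. g n v * u v)"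
    by (rule sum.swap_restrict) auto
  also have "\<dots> = (\<Sum>v=1..N. (\<Sum>n=Suc v..N. g n v) * u v)"
    unfolding sum_distrib_right by (intro sum.cong refl) auto
  also have "\<dots> \<le> (\<Sum>v=1..N. B v * u v)"
    by (intro sum_mono mult_right_mono col u) auto
  finally show ?thesis .
qed

text \<open>The three groups come from the discrete product rule for
  \<open>hat_mat a n v * lam v / v\<close>: the difference falls on the matrix, on \<open>lam\<close>, or on \<open>1 / v\<close>; the last two
  carry the same matrix entry and are joined. The isolated term is the boundary term of the
  summation by parts.\<close>

definition transform_majorant :: "(nat \<Rightarrow> nat \<Rightarrow> real) \<Rightarrow> (nat \<Rightarrow> real) \<Rightarrow> nat \<Rightarrow> real" where
  "transform_majorant a lam n = a n n * \<bar>lam n\<bar>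
     + (\<Sum>v=1..<n. (a (n - 1) v - a n v) * \<bar>lam v\<bar>)
     + (\<Sum>v=1..<n. hat_mat a n (Suc v) * (\<bar>lam v - lam (Suc v)\<bar> + \<bar>lam (Suc v)\<bar> / Suc v))"

text \<open>The bound on the means enters as \<open>\<bar>S v\<bar> / v \<le> M\<close>. One factor \<open>1 / v\<close> is therefore taken out of each
  difference of \<open>hat_mat a n v * lam v / v\<close>; of \<open>1 / v - 1 / (v + 1) = 1 / (v * (v + 1))\<close> it leaves the
  \<open>1 / (v + 1)\<close> of the majorant.\<close>

lemma transform_diff_le_majorant:
  fixes a :: "nat \<Rightarrow> nat \<Rightarrow> real" and c lam :: "nat \<Rightarrow> real" and M :: real
  assumes upper: "\<And>n v. n < v \<Longrightarrow> a n v = 0" 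
    and nonneg: "\<And>n v. 0 \<le> a n v"
    and rows: "\<And>n. bar_mat a n 0 = 1"
    and decr: "\<And>n v. v + 1 \<le> n \<Longrightarrow> a n v \<le> a (n - 1) v"
    and means: "\<And>n. \<bar>\<Sum>v=1..n. v * c v\<bar> \<le> M * n"
    and "1 \<le> n"
  shows "\<bar>\<Sum>v=1..n. hat_mat a n v * (c v * lam v)\<bar> \<le> M * transform_majorant a lam n"
proof -
  define S where "S v = (\<Sum>u=1..v. u * c u)" for v
  define h where "h v = hat_mat a n v" for v
  have S: "\<bar>S v\<bar> / v \<le> M" if "1 \<le> v" for v
    using means[of v] that by (simp add: S_def field_simps)
  have "0 \<le> M" using S[of 1] by simp
  have step: "\<bar>(h v * lam v / v - h (Suc v) * lam (Suc v) / Suc v) * S v\<bar>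
      \<le> M * ((a (n - 1) v - a n v) * \<bar>lam v\<bar>
         + h (Suc v) * (\<bar>lam v - lam (Suc v)\<bar> + \<bar>lam (Suc v)\<bar> / Suc v))"
    (is "?L \<le> M * ?R") if "1 \<le> v" "v < n" for v
  proof -
    have hpos: "0 \<le> h (Suc v)" 
      unfolding h_def using hat_mat_bounds[where a=a and v=v and n=n, OF rows decr] that by simp
    have hd: "h v = h (Suc v) - (a (n - 1) v - a n v)"
      unfolding h_def using hat_mat_diff_column[of v n a] that by simp
    have ad: "0 \<le> a (n - 1) v - a n v" using decr[of v n] that by simp
    have "(h v * lam v / v - h (Suc v) * lam (Suc v) / Suc v) * S v
      = (- (a (n - 1) v - a n v) * lam v + h (Suc v) * (lam v - lam (Suc v) + lam (Suc v) / Suc v)) * (S v / v)"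
      using that unfolding hd by (simp add: field_simps)
    also have "\<bar>\<dots>\<bar> \<le> ?R * M"
      unfolding abs_mult
    proof (rule mult_mono)
      have "\<bar>lam v - lam (Suc v) + lam (Suc v) / Suc v\<bar> \<le> \<bar>lam v - lam (Suc v)\<bar> + \<bar>lam (Suc v)\<bar> / Suc v"
        by (rule order_trans[OF abs_triangle_ineq]) simp
      then have "h (Suc v) * \<bar>lam v - lam (Suc v) + lam (Suc v) / Suc v\<bar>
         \<le> h (Suc v) * (\<bar>lam v - lam (Suc v)\<bar> + \<bar>lam (Suc v)\<bar> / Suc v)"
        using hpos by (rule mult_left_mono)
      moreover have "\<bar>- (a (n - 1) v - a n v) * lam v\<bar> = (a (n - 1) v - a n v) * \<bar>lam v\<bar>"
        using ad by (simp add: abs_mult)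
      moreover have "\<bar>h (Suc v) * (lam v - lam (Suc v) + lam (Suc v) / Suc v)\<bar>
         = h (Suc v) * \<bar>lam v - lam (Suc v) + lam (Suc v) / Suc v\<bar>"
        using hpos by (simp add: abs_mult)
      ultimately show "\<bar>- (a (n - 1) v - a n v) * lam v + h (Suc v) * (lam v - lam (Suc v) + lam (Suc v) / Suc v)\<bar> \<le> ?R"
        by linarith
      show "\<bar>S v / v\<bar> \<le> M" using S[OF that(1)] by simp
      show "0 \<le> ?R" using ad hpos by simp
    qed simp
    finally show ?thesis by (simp add: mult.commute)
  qed
  have last: "\<bar>h n * lam n / n * S n\<bar> \<le> M * (a n n * \<bar>lam n\<bar>)"
  proof -
    have "h n = a n n" unfolding h_def using upper by (rule hat_mat_diag)
    then have "\<bar>h n * lam n / n * S n\<bar> = a n n * \<bar>lam n\<bar> * (\<bar>S n\<bar> / n)"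
      using nonneg[of n n] by (simp add: abs_mult)
    also have "\<dots> \<le> a n n * \<bar>lam n\<bar> * M"
      using S[OF \<open>1 \<le> n\<close>] nonneg[of n n] by (intro mult_left_mono) auto
    finally show ?thesis by (simp add: mult_ac)
  qed
  define F where "F v = (h v * lam v / v - h (Suc v) * lam (Suc v) / Suc v) * S v" for v
  define G where "G v = (a (n - 1) v - a n v) * \<bar>lam v\<bar>
         + h (Suc v) * (\<bar>lam v - lam (Suc v)\<bar> + \<bar>lam (Suc v)\<bar> / Suc v)" for v
  have "\<bar>\<Sum>v=1..<n. F v\<bar> \<le> (\<Sum>v=1..<n. \<bar>F v\<bar>)"
    by (rule sum_abs)
  also have "\<dots> \<le> (\<Sum>v=1..<n. M * G v)"
    using step unfolding F_def G_def by (intro sum_mono) auto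
  finally have F: "\<bar>\<Sum>v=1..<n. F v\<bar> \<le> M * (\<Sum>v=1..<n. G v)"
    by (simp only: sum_distrib_left)
  have "(\<Sum>v=1..n. hat_mat a n v * (c v * lam v)) = (\<Sum>v=1..n. (h v * lam v) * c v)"
    by (simp add: h_def mult_ac)
  also have "\<dots> = (\<Sum>v=1..<n. F v) + h n * lam n / n * S n"
    unfolding S_def F_def by (rule sum_by_parts_weighted[OF \<open>1 \<le> n\<close>])
  also have "\<bar>\<dots>\<bar> \<le> M * (\<Sum>v=1..<n. G v) + M * (a n n * \<bar>lam n\<bar>)"
    using F last by linarith
  also have "\<dots> = M * transform_majorant a lam n"
    unfolding transform_majorant_def G_def sum.distrib h_def by (simp only: distrib_left add_ac)
  finally show ?thesis .
qed

lemma transform_majorant_nonneg: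
  fixes a :: "nat \<Rightarrow> nat \<Rightarrow> real"
  assumes nonneg: "\<And>n v. 0 \<le> a n v"
    and rows: "\<And>n. bar_mat a n 0 = 1"
    and decr: "\<And>n v. v + 1 \<le> n \<Longrightarrow> a n v \<le> a (n - 1) v"
  shows "0 \<le> transform_majorant a lam n"
proof -
  have "0 \<le> hat_mat a n (Suc v)" if "v < n" for v
    using hat_mat_bounds[where a=a and v=v and n=n, OF rows decr] that by simp
  moreover have "0 \<le> a (n - 1) v - a n v" if "v < n" for v
    using decr[of v n] that by simp
  ultimately show ?thesis
    unfolding transform_majorant_def
    using nonneg by (intro add_nonneg_nonneg sum_nonneg mult_nonneg_nonneg) auto
qed

text \<open>Row-wise estimate: the decreases of a row add up to \<open>a n n\<close>, and each entry of \<open>hat_mat\<close> is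
  at most \<open>a n n\<close>.\<close>

lemma transform_majorant_le_diag:
  fixes a :: "nat \<Rightarrow> nat \<Rightarrow> real"
  assumes nonneg: "\<And>n v. 0 \<le> a n v"
    and rows: "\<And>n. bar_mat a n 0 = 1"
    and decr: "\<And>n v. v + 1 \<le> n \<Longrightarrow> a n v \<le> a (n - 1) v"
    and L: "\<And>v. \<bar>lam v\<bar> \<le> L"
    and W: "\<And>N. (\<Sum>v=1..<N. \<bar>lam v - lam (Suc v)\<bar> + \<bar>lam (Suc v)\<bar> / Suc v) \<le> W"
    and "1 \<le> n"
  shows "transform_majorant a lam n \<le> a n n * (2 * L + W)"
proof -
  have "0 \<le> L" using L[of 0] by linarith
  have d: "0 \<le> a (n - 1) v - a n v" if "v < n" for v
    using decr[of v n] that by simp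
  have "a n n * \<bar>lam n\<bar> \<le> a n n * L"
    by (intro mult_left_mono L nonneg)
  moreover have "(\<Sum>v=1..<n. (a (n - 1) v - a n v) * \<bar>lam v\<bar>) \<le> a n n * L"
  proof -
    have "(\<Sum>v=1..<n. (a (n - 1) v - a n v) * \<bar>lam v\<bar>) \<le> (\<Sum>v=1..<n. (a (n - 1) v - a n v) * L)"
      using d by (intro sum_mono mult_left_mono L) auto
    also have "\<dots> \<le> (\<Sum>v<n. (a (n - 1) v - a n v) * L)"
      using d \<open>0 \<le> L\<close> by (intro sum_mono2) auto
    also have "\<dots> = a n n * L"
      using sum_row_decrease[where a=a and n=n, OF rows] \<open>1 \<le> n\<close> by (simp flip: sum_distrib_right)
    finally show ?thesis .
  qed
  moreover have "(\<Sum>v=1..<n. hat_mat a n (Suc v) * (\<bar>lam v - lam (Suc v)\<bar> + \<bar>lam (Suc v)\<bar> / Suc v)) \<le> a n n * W"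
  proof -
    have "(\<Sum>v=1..<n. hat_mat a n (Suc v) * (\<bar>lam v - lam (Suc v)\<bar> + \<bar>lam (Suc v)\<bar> / Suc v))
      \<le> (\<Sum>v=1..<n. a n n * (\<bar>lam v - lam (Suc v)\<bar> + \<bar>lam (Suc v)\<bar> / Suc v))"
      using hat_mat_bounds(2)[of a _ n, OF rows decr] by (intro sum_mono mult_right_mono) auto
    also have "\<dots> \<le> a n n * W"
      using W[of n] nonneg by (simp add: mult_left_mono flip: sum_distrib_left)
    finally show ?thesis .
  qed
  ultimately show ?thesis unfolding transform_majorant_def by (simp add: distrib_left)
qed

text \<open>Column-wise estimate: for fixed \<open>v\<close> the decreases of column \<open>v\<close> telescope to at most \<open>a v v\<close>.
  Those of \<open>hat_mat\<close> telescope to at most \<open>\<Sum>i\<le>v. a v i = 1\<close>.\<close>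

lemma transform_majorant_summable:
  fixes a :: "nat \<Rightarrow> nat \<Rightarrow> real"
  assumes nonneg: "\<And>n v. 0 \<le> a n v"
    and rows: "\<And>n. bar_mat a n 0 = 1"
    and decr: "\<And>n v. v + 1 \<le> n \<Longrightarrow> a n v \<le> a (n - 1) v"
    and D: "\<And>N. (\<Sum>v=1..N. a v v * \<bar>lam v\<bar>) \<le> D"
    and W: "\<And>N. (\<Sum>v=1..<N. \<bar>lam v - lam (Suc v)\<bar> + \<bar>lam (Suc v)\<bar> / Suc v) \<le> W"
  shows "summable (\<lambda>n. transform_majorant a lam (Suc n))"
proof (rule summableI_nonneg_bounded)
  show "0 \<le> transform_majorant a lam (Suc n)" for n
    by (rule transform_majorant_nonneg[OF nonneg rows decr])
  fix N
  have "(\<Sum>n=1..N. \<Sum>v=1..<n. (a (n - 1) v - a n v) * \<bar>lam v\<bar>) \<le> (\<Sum>v=1..N. a v v * \<bar>lam v\<bar>)"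
    using nonneg by (intro sum_triangle_le) (simp_all add: sum_column_decrease del: One_nat_def)
  moreover have "(\<Sum>n=1..N. \<Sum>v=1..<n. hat_mat a n (Suc v) * (\<bar>lam v - lam (Suc v)\<bar> + \<bar>lam (Suc v)\<bar> / Suc v))
     \<le> (\<Sum>v=1..N. 1 * (\<bar>lam v - lam (Suc v)\<bar> + \<bar>lam (Suc v)\<bar> / Suc v))"
  proof (rule sum_triangle_le)
    fix v assume "1 \<le> v" "v \<le> N"
    have "(\<Sum>n=Suc v..N. hat_mat a n (Suc v)) = (\<Sum>n=Suc v..N. \<Sum>i=0..v. a (n - 1) i - a n i)"
      by (intro sum.cong refl hat_mat_eq_row_decrease rows) auto
    also have "\<dots> = (\<Sum>i=0..v. \<Sum>n=Suc v..N. a (n - 1) i - a n i)"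
      by (rule sum.swap)
    also have "\<dots> = (\<Sum>i=0..v. a v i - a N i)"
      using \<open>v \<le> N\<close> by (simp only: sum_column_decrease)
    also have "\<dots> \<le> (\<Sum>i=0..v. a v i)"
      using nonneg by (intro sum_mono) auto
    also have "\<dots> = 1" using rows[of v] by (simp add: bar_mat_def)
    finally show "(\<Sum>n=Suc v..N. hat_mat a n (Suc v)) \<le> 1" .
  qed auto
  moreover have "(\<Sum>v=1..N. \<bar>lam v - lam (Suc v)\<bar> + \<bar>lam (Suc v)\<bar> / Suc v) \<le> W"
    using W[of "Suc N"] by (simp add: atLeastLessThanSuc_atLeastAtMost)
  moreover have "(\<Sum>n<N. transform_majorant a lam (Suc n)) = (\<Sum>n=1..N. transform_majorant a lam n)"
    by (rule sum.atLeast1_atMost_eq [symmetric, unfolded One_nat_def, folded One_nat_def])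
  ultimately show "(\<Sum>n<N. transform_majorant a lam (Suc n)) \<le> 2 * D + W"
    using D[of N] unfolding transform_majorant_def by (simp add: sum.distrib)
qed

text \<open>The majorant is used twice: its row-wise bound makes \<open>(P/p * \<bar>T\<bar>)\<^sup>k\<^sup>-\<^sup>1\<close> bounded, which leaves only one
  factor \<open>\<bar>T\<bar>\<close> to be summed by the column-wise bound.\<close>

theorem abs_summable_matrix_of_bounded_means:
  fixes a :: "nat \<Rightarrow> nat \<Rightarrow> real" and c lam :: "nat \<Rightarrow> real" and M :: real
  assumes k: "1 \<le> k"
    and p_pos: "\<And>n. 0 < p n"
    and upper: "\<And>n v. n < v \<Longrightarrow> a n v = 0" 
    and nonneg: "\<And>n v. 0 \<le> a n v"
    and rows: "\<And>n. bar_mat a n 0 = 1"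
    and decr: "\<And>n v. v + 1 \<le> n \<Longrightarrow> a n v \<le> a (n - 1) v"
    and diag: "\<And>n. a n n \<le> C * (p n / P_sum p n)"
    and means: "\<And>n. \<bar>\<Sum>v=1..n. v * c v\<bar> \<le> M * n"
    and L: "\<And>v. \<bar>lam v\<bar> \<le> L"
    and D: "\<And>N. (\<Sum>v=1..N. a v v * \<bar>lam v\<bar>) \<le> D"
    and W: "\<And>N. (\<Sum>v=1..<N. \<bar>lam v - lam (Suc v)\<bar> + \<bar>lam (Suc v)\<bar> / Suc v) \<le> W"
  shows "abs_summable_matrix a p k (\<lambda>n. c n * lam n)"
proof -
  define E where "E n = transform_majorant a lam n" for n
  define T where "T n = mat_transform a (\<lambda>n. \<Sum>v=1..n. c v * lam v) (Suc n)
       - mat_transform a (\<lambda>n. \<Sum>v=1..n. c v * lam v) n" for n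
  have E0: "0 \<le> E n" for n 
    unfolding E_def by (rule transform_majorant_nonneg[OF nonneg rows decr])
  have "0 \<le> M" using means[of 1] by simp
  have "0 \<le> L" using L[of 0] by linarith
  have "0 \<le> W" using W[of 0] by simp
  have Ppos: "0 < P_sum p n" for n
    unfolding P_sum_def using p_pos by (intro sum_pos) auto
  have T: "\<bar>T n\<bar> \<le> M * E (Suc n)" for n
    unfolding T_def E_def
    using transform_diff_le_majorant[where c=c and lam=lam and M=M and a=a and n="Suc n", OF upper nonneg rows decr means]
      mat_transform_diff[of "Suc n" a "\<lambda>v. c v * lam v"] by simp
  define H where "H = C * (M * (2 * L + W))"
  have bounded: "P_sum p (Suc n) / p (Suc n) * \<bar>T n\<bar> \<le> H" for n
  proof -
    have "E (Suc n) \<le> a (Suc n) (Suc n) * (2 * L + W)"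
      unfolding E_def
      using transform_majorant_le_diag[where a=a and lam=lam and L=L and W=W and n="Suc n", OF nonneg rows decr L W]
      by simp
    then have "\<bar>T n\<bar> \<le> M * (a (Suc n) (Suc n) * (2 * L + W))"
      using T[of n] \<open>0 \<le> M\<close> by (meson mult_left_mono order_trans)
    also have "\<dots> = a (Suc n) (Suc n) * (M * (2 * L + W))" by simp
    also have "\<dots> \<le> C * (p (Suc n) / P_sum p (Suc n)) * (M * (2 * L + W))"
      using \<open>0 \<le> M\<close> \<open>0 \<le> L\<close> \<open>0 \<le> W\<close> by (intro mult_right_mono diag) auto
    finally have "\<bar>T n\<bar> \<le> H * (p (Suc n) / P_sum p (Suc n))"
      by (simp add: H_def mult_ac)
    then show ?thesis using p_pos[of "Suc n"] Ppos[of "Suc n"] by (simp add: field_simps)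
  qed
  have "summable (\<lambda>n. H powr (k - 1) * (M * E (Suc n)))"
    unfolding E_def
    by (intro summable_mult transform_majorant_summable[OF nonneg rows decr D W])
  then have "summable (\<lambda>n. (P_sum p (Suc n) / p (Suc n)) powr (k - 1) * \<bar>T n\<bar> powr k)"
  proof (rule summable_comparison_test')
    fix n :: nat
    define q where "q = P_sum p (Suc n) / p (Suc n)"
    have "0 \<le> q" using p_pos[of "Suc n"] Ppos[of "Suc n"] by (simp add: q_def)
    have "q powr (k - 1) * \<bar>T n\<bar> powr k = (q * \<bar>T n\<bar>) powr (k - 1) * \<bar>T n\<bar>"
      using \<open>0 \<le> q\<close> powr_add[of "\<bar>T n\<bar>" "k - 1" 1] by (simp add: powr_mult)
    also have "\<dots> \<le> H powr (k - 1) * (M * E (Suc n))"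
      using bounded[of n] k \<open>0 \<le> q\<close> T[of n]
      by (intro mult_mono powr_mono2) (auto simp: q_def[symmetric])
    finally show "norm ((P_sum p (Suc n) / p (Suc n)) powr (k - 1) * \<bar>T n\<bar> powr k) \<le> H powr (k - 1) * (M * E (Suc n))"
      by (simp add: q_def)
  qed
  then show ?thesis
    unfolding abs_summable_matrix_def T_def Let_def .
qed

section \<open>Integrals of periodic functions and the cosine coefficients\<close>

lemma absolutely_integrable_shift:
  fixes f :: "real \<Rightarrow> real"
  assumes "f absolutely_integrable_on {a..b}"
  shows "(\<lambda>t. f (t + c)) absolutely_integrable_on {a - c..b - c}"
  using assms unfolding absolutely_integrable_on_def
  using integrable_shift_real_ivl[of f a b c] integrable_shift_real_ivl[of "\<lambda>t. norm (f t)" a b c] by blast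

text \<open>Gluing translates: each induction step adds one period on both sides.\<close>

lemma periodic_absolutely_integrable:
  fixes f :: "real \<Rightarrow> real"
  assumes per: "\<And>t. f (t + T) = f t" and "0 < T"
    and int: "f absolutely_integrable_on {c..c + T}"
  shows "f absolutely_integrable_on {a..b}"
proof -
  have per': "f (t - T) = f t" for t using per[of "t - T"] by simp
  have wide: "f absolutely_integrable_on {c - real N * T..c + T + real N * T}" for N
  proof (induction N)
    case 0
    then show ?case using int by simp
  next
    case (Suc N)
    have left: "f absolutely_integrable_on {c - real N * T - T..c + T + real N * T - T}"
      using absolutely_integrable_shift[OF Suc, of T] by (simp add: per)
    have right: "f absolutely_integrable_on {c - real N * T + T..c + T + real N * T + T}"
      using absolutely_integrable_shift[OF Suc, of "-T"] by (simp add: per')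
    have "f absolutely_integrable_on
      {c - real N * T - T..c + T + real N * T - T} \<union> {c - real N * T + T..c + T + real N * T + T}
        \<union> {c - real N * T..c + T + real N * T}"
      by (intro set_integrable_Un left right Suc) auto
    moreover have "{c - r - T..c + T + r - T} \<union> {c - r + T..c + T + r + T} \<union> {c - r..c + T + r}
        = {c - (r + T)..c + T + (r + T)}" if "0 \<le> r" for r
      using that \<open>0 < T\<close> by auto
    from this[of "real N * T"] have "{c - real N * T - T..c + T + real N * T - T}
        \<union> {c - real N * T + T..c + T + real N * T + T} \<union> {c - real N * T..c + T + real N * T}
        = {c - real (Suc N) * T..c + T + real (Suc N) * T}"
      using \<open>0 < T\<close> by (simp add: distrib_right add.commute)
    ultimately show ?case by simp
  qed
  obtain N :: nat where N: "(\<bar>a - c\<bar> + \<bar>b - c\<bar>) / T \<le> real N"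
    using real_arch_simple by blast
  then have "\<bar>a - c\<bar> + \<bar>b - c\<bar> \<le> real N * T"
    using \<open>0 < T\<close> by (simp add: field_simps)
  then have "{a..b} \<subseteq> {c - real N * T..c + T + real N * T}"
    using \<open>0 < T\<close> by auto
  then show ?thesis
    by (rule absolutely_integrable_on_subinterval[OF wide])
qed

lemma periodic_integral:
  fixes G :: "real \<Rightarrow> real"
  assumes per: "\<And>t. G (t + T) = G t" and "0 < T"
    and int: "\<And>a b. G integrable_on {a..b}"
  shows "integral {a..a + T} G = integral {b..b + T} G"
proof -
  have aux: "integral {a..a + T} G = integral {b..b + T} G" if "a \<le> b" for a b
  proof -
    have "integral {a..b} G = integral {a + T..b + T} G"
      using integral_shift_real_ivl[of "a + T" T "b + T" G] by (simp add: per)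
    moreover have "integral {a..b} G + integral {b..b + T} G = integral {a..b + T} G"
      using that \<open>0 < T\<close> by (intro Henstock_Kurzweil_Integration.integral_combine int) auto
    moreover have "integral {a..a + T} G + integral {a + T..b + T} G = integral {a..b + T} G"
      using that \<open>0 < T\<close> by (intro Henstock_Kurzweil_Integration.integral_combine int) auto
    ultimately show ?thesis by simp
  qed
  show ?thesis using aux[of a b] aux[of b a] by linarith
qed

lemma absolutely_integrable_mult_continuous:
  fixes f g :: "real \<Rightarrow> real"
  assumes "f absolutely_integrable_on {a..b}" and "continuous_on {a..b} g"
  shows "(\<lambda>t. f t * g t) absolutely_integrable_on {a..b}"
proof -
  have "(\<lambda>t. g t * f t) absolutely_integrable_on {a..b}"
    using assms
    by (intro absolutely_integrable_bounded_measurable_product_real continuous_imp_measurable_on_sets_lebesgue)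
      (auto intro!: compact_imp_bounded compact_continuous_image)
  then show ?thesis by (simp add: mult.commute)
qed

text \<open>The addition theorem turns the term into the integral of \<open>f u * cos (n * (u - x))\<close>; the window of
  integration is moved to be centred at \<open>x\<close>, and its two halves are folded together by reflection.\<close>

lemma fourier_term_eq_cosine_integral:
  fixes f :: "real \<Rightarrow> real"
  assumes per: "\<And>t. f (t + 2 * pi) = f t"
    and int: "\<And>a b. f absolutely_integrable_on {a..b}"
  shows "fourier_term f n x = 2 / pi * integral {0..pi} (\<lambda>t. phi f x t * cos (n * t))"
proof -
  define G where "G u = f u * cos (n * (u - x))" for u
  have icos: "(\<lambda>u. f u * cos (n * u)) absolutely_integrable_on {a..b}"
    and isin: "(\<lambda>u. f u * sin (n * u)) absolutely_integrable_on {a..b}"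
    and iG: "G absolutely_integrable_on {a..b}" for a b
    unfolding G_def by (intro absolutely_integrable_mult_continuous int continuous_intros)+
  have iG': "G integrable_on {a..b}" for a b
    using iG absolutely_integrable_on_def by blast
  have perG: "G (u + 2 * pi) = G u" for u
  proof -
    have "cos (n * (u + 2 * pi - x)) = cos (n * (u - x) + 2 * n * pi)" 
      by (simp add: algebra_simps)
    also have "\<dots> = cos (n * (u - x))" by (simp only: cos_add cos_2npi sin_2npi) simp
    finally show ?thesis by (simp add: G_def per)
  qed
  have "integral {- pi..pi} G = integral {-pi..pi} (\<lambda>u. cos (n * x) * (f u * cos (n * u)) + sin (n * x) * (f u * sin (n * u)))"
    unfolding G_def by (intro integral_cong) (simp add: right_diff_distrib cos_diff algebra_simps)
  also have "\<dots> = cos (n * x) * integral {-pi..pi} (\<lambda>u. f u * cos (n * u)) + sin (n * x) * integral {-pi..pi} (\<lambda>u. f u * sin (n * u))"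
    using icos[of "-pi" pi] isin[of "-pi" pi]
    by (subst integral_add) (auto simp: absolutely_integrable_on_def intro!: integrable_on_mult_right)
  also have "\<dots> = pi * fourier_term f n x"
    unfolding fourier_term_def set_lebesgue_integral_eq_integral(2)[OF icos] set_lebesgue_integral_eq_integral(2)[OF isin]
    by (simp add: field_simps)
  finally have "pi * fourier_term f n x = integral {- pi..pi} G" by simp
  also have "\<dots> = integral {x - pi..x + pi} G"
    using periodic_integral[of G "2 * pi" "- pi" "x - pi", OF perG _ iG'] by (simp add: add.commute)
  also have "\<dots> = integral {-pi..pi} (\<lambda>t. G (t + x))"
    using integral_shift_real_ivl[of "x - pi" x "x + pi" G] by simp
  also have "\<dots> = integral {-pi..0} (\<lambda>t. G (t + x)) + integral {0..pi} (\<lambda>t. G (t + x))"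
    using integrable_shift_real_ivl[OF iG'[of "x - pi" "x + pi"], of x]
    by (intro Henstock_Kurzweil_Integration.integral_combine[symmetric]) auto
  also have "integral {-pi..0} (\<lambda>t. G (t + x)) = integral {0..pi} (\<lambda>t. G (- t + x))"
    using Henstock_Kurzweil_Integration.integral_reflect_real[where a = 0 and b = pi and f = "\<lambda>t. G (- t + x)"]
    by simp
  also have "integral {0..pi} (\<lambda>t. G (- t + x)) + integral {0..pi} (\<lambda>t. G (t + x))
     = integral {0..pi} (\<lambda>t. G (- t + x) + G (t + x))"
  proof (intro integral_add[symmetric])
    show "(\<lambda>t. G (t + x)) integrable_on {0..pi}"
      using integrable_shift_real_ivl[OF iG'[of "x" "x + pi"], of x] by simp
    show "(\<lambda>t. G (- t + x)) integrable_on {0..pi}"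
      using integrable_shift_real_ivl[OF iG'[of "x - pi" "x"], of x]
        Henstock_Kurzweil_Integration.integrable_reflect_real[where a = "-pi" and b = 0 and f = "\<lambda>t. G (t + x)"] by simp
  qed
  also have "\<dots> = integral {0..pi} (\<lambda>t. 2 * (phi f x t * cos (n * t)))"
    by (intro integral_cong) (simp add: G_def phi_def algebra_simps)
  also have "\<dots> = 2 * integral {0..pi} (\<lambda>t. phi f x t * cos (n * t))"
    by simp
  finally show ?thesis by (simp add: field_simps)
qed

lemma phi_absolutely_integrable:
  assumes int: "\<And>a b. f absolutely_integrable_on {a..b}"
  shows "phi f x absolutely_integrable_on {a..b}"
proof -
  have 1: "(\<lambda>t. f (t + x)) absolutely_integrable_on {a..b}" for a b
    using absolutely_integrable_shift[OF int[of "a + x" "b + x"], of x] by simp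
  have "(\<lambda>t. f (- t + x)) absolutely_integrable_on {a..b}"
    using absolutely_integrable_reflect_real[where f="\<lambda>t. f (t + x)" and a="-b" and b="-a"] 1[of "-b" "-a"] by simp
  then have "(\<lambda>t. 1 / 2 * (f (t + x) + f (- t + x))) absolutely_integrable_on {a..b}"
    using 1[of a b] by (intro set_integrable_mult_right set_integral_add)
  then show ?thesis unfolding phi_def by (simp add: add.commute)
qed

section \<open>Pairing a function with a kernel when its mean has bounded variation\<close>

text \<open>On each cell the kernel is frozen at the left endpoint. Only the oscillation of the kernel
  enters, which suits a \<open>\<phi>\<close> that is merely integrable: the sum sees it only through its indefinite
  integral, and the error only through the integral of its absolute value.\<close>

lemma riemann_sum_product_error:
  fixes \<phi> K :: "real \<Rightarrow> real" and t :: "nat \<Rightarrow> real"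
  assumes int: "\<phi> absolutely_integrable_on {0..b}"
    and K: "continuous_on {0..b} K"
    and mono: "\<And>i. i < m \<Longrightarrow> t i \<le> t (Suc i)" and t0: "t 0 = 0"
    and tb: "\<And>i. i \<le> m \<Longrightarrow> 0 \<le> t i \<and> t i \<le> b"
    and osc: "\<And>i s. i < m \<Longrightarrow> t i \<le> s \<Longrightarrow> s \<le> t (Suc i) \<Longrightarrow> \<bar>K s - K (t i)\<bar> \<le> e"
  shows "\<bar>integral {0..t m} (\<lambda>s. \<phi> s * K s)
      - (\<Sum>i<m. K (t i) * (integral {0..t (Suc i)} \<phi> - integral {0..t i} \<phi>))\<bar>
     \<le> e * integral {0..t m} (\<lambda>s. \<bar>\<phi> s\<bar>)"
proof -
  have i\<phi>: "\<phi> integrable_on {c..d}" and ia: "(\<lambda>s. \<bar>\<phi> s\<bar>) integrable_on {c..d}"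
    and iK: "(\<lambda>s. \<phi> s * K s) integrable_on {c..d}" if "0 \<le> c" "d \<le> b" for c d
  proof -
    have sub: "{c..d} \<subseteq> {0..b}" using that by auto
    then have "\<phi> absolutely_integrable_on {c..d}"
      using int absolutely_integrable_on_subinterval by blast
    then show "\<phi> integrable_on {c..d}" "(\<lambda>s. \<bar>\<phi> s\<bar>) integrable_on {c..d}"
      unfolding absolutely_integrable_on_def by auto
    have "(\<lambda>s. \<phi> s * K s) absolutely_integrable_on {c..d}"
      using \<open>\<phi> absolutely_integrable_on {c..d}\<close> continuous_on_subset[OF K sub]
      by (rule absolutely_integrable_mult_continuous)
    then show "(\<lambda>s. \<phi> s * K s) integrable_on {c..d}"
      unfolding absolutely_integrable_on_def by simp
  qed
  have split: "integral {0..t (Suc j)} g = integral {0..t j} g + integral {t j..t (Suc j)} g"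
    if "j < m" "g integrable_on {0..t (Suc j)}" for j and g :: "real \<Rightarrow> real"
    using that tb[of j] tb[of "Suc j"] mono[of j]
    by (intro Henstock_Kurzweil_Integration.integral_combine[symmetric]) auto
  have "\<bar>integral {0..t j} (\<lambda>s. \<phi> s * K s)
      - (\<Sum>i<j. K (t i) * (integral {0..t (Suc i)} \<phi> - integral {0..t i} \<phi>))\<bar>
     \<le> e * integral {0..t j} (\<lambda>s. \<bar>\<phi> s\<bar>)" if "j \<le> m" for j
    using that
  proof (induction j)
    case 0
    then show ?case by (simp add: t0)
  next
    case (Suc j)
    then have j: "j < m" "0 \<le> t j" "t (Suc j) \<le> b" using tb[of j] tb[of "Suc j"] by auto
    note ints = i\<phi>[OF j(2,3)] ia[OF j(2,3)] iK[OF j(2,3)]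
    have "\<bar>integral {t j..t (Suc j)} (\<lambda>s. \<phi> s * K s) - K (t j) * integral {t j..t (Suc j)} \<phi>\<bar>
      = norm (integral {t j..t (Suc j)} (\<lambda>s. \<phi> s * K s - K (t j) * \<phi> s))"
      using ints by (subst integral_diff) (auto intro!: integrable_on_mult_right)
    also have "norm (integral {t j..t (Suc j)} (\<lambda>s. \<phi> s * K s - K (t j) * \<phi> s))
        \<le> integral {t j..t (Suc j)} (\<lambda>s. e * \<bar>\<phi> s\<bar>)"
    proof (rule integral_norm_bound_integral)
      fix s assume s: "s \<in> {t j..t (Suc j)}"
      have "\<bar>\<phi> s * K s - K (t j) * \<phi> s\<bar> = \<bar>K s - K (t j)\<bar> * \<bar>\<phi> s\<bar>"
        by (simp add: algebra_simps flip: abs_mult)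
      also have "\<dots> \<le> e * \<bar>\<phi> s\<bar>"
        using osc[OF j(1)] s by (intro mult_right_mono) auto
      finally show "norm (\<phi> s * K s - K (t j) * \<phi> s) \<le> e * \<bar>\<phi> s\<bar>" by simp
    qed (use ints in \<open>auto intro!: integrable_diff integrable_on_mult_right\<close>)
    also have "\<dots> = e * integral {t j..t (Suc j)} (\<lambda>s. \<bar>\<phi> s\<bar>)" by simp
    finally have new: "\<bar>integral {t j..t (Suc j)} (\<lambda>s. \<phi> s * K s) - K (t j) * integral {t j..t (Suc j)} \<phi>\<bar>
       \<le> e * integral {t j..t (Suc j)} (\<lambda>s. \<bar>\<phi> s\<bar>)" .
    have old: "\<bar>integral {0..t j} (\<lambda>s. \<phi> s * K s)
      - (\<Sum>i<j. K (t i) * (integral {0..t (Suc i)} \<phi> - integral {0..t i} \<phi>))\<bar>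
     \<le> e * integral {0..t j} (\<lambda>s. \<bar>\<phi> s\<bar>)" using Suc by simp
    show ?case
      using old new
      unfolding split[OF j(1) i\<phi>[OF order_refl j(3)]] split[OF j(1) ia[OF order_refl j(3)]] split[OF j(1) iK[OF order_refl j(3)]]
      by (simp add: split[OF j(1) i\<phi>[OF order_refl j(3)]] distrib_left)
  qed
  then show ?thesis by simp
qed

lemma sum_diff_times_by_parts:
  fixes D q :: "nat \<Rightarrow> real"
  assumes "D 0 = 0"
  shows "(\<Sum>i<m. (D (Suc i) - D i) * q (Suc i)) = D m * q m - (\<Sum>i<m. D i * (q (Suc i) - q i))"
  using assms by (induction m) (simp_all add: algebra_simps)

text \<open>A partition form of \<open>\<integral>\<phi> K = \<integral> t K dq + \<integral> q K dt\<close>, where \<open>t * q t\<close> is the indefinite integral of \<open>\<phi>\<close>.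
  The first integral is at most \<open>\<kappa> * W\<close>; in the second \<open>K dt = dD\<close> is moved onto \<open>q\<close>. The variation sum
  begins at \<open>i = 1\<close>, because the weights \<open>t * K t\<close> and \<open>D t\<close> vanish at 0, where \<open>q\<close>, a quotient by \<open>t\<close>,
  has no meaningful value. The Lipschitz constant \<open>L\<close> affects only the error terms, which vanish as the
  partition is refined; in the application it grows like \<open>n\<^sup>3\<close>, whereas \<open>\<kappa>\<close> and \<open>\<beta>\<close> are linear in \<open>n\<close>.\<close>

theorem integral_product_bound_of_mean_variation:
  fixes \<phi> q K D :: "real \<Rightarrow> real"
  assumes b: "0 < b"
    and int: "\<phi> absolutely_integrable_on {0..b}"
    and mean: "\<And>t. 0 < t \<Longrightarrow> t \<le> b \<Longrightarrow> integral {0..t} \<phi> = t * q t"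
    and bound: "\<And>t. 0 < t \<Longrightarrow> t \<le> b \<Longrightarrow> \<bar>q t\<bar> \<le> B"
    and variation: "\<And>m. (\<Sum>i=1..<m. \<bar>q (real (Suc i) * (b / m)) - q (real i * (b / m))\<bar>) \<le> W"
    and lip: "\<And>s t. s \<in> {0..b} \<Longrightarrow> t \<in> {0..b} \<Longrightarrow> \<bar>K s - K t\<bar> \<le> L * \<bar>s - t\<bar>"
    and D: "\<And>t. (D has_real_derivative K t) (at t)" and D0: "D 0 = 0"
    and Dbound: "\<And>t. t \<in> {0..b} \<Longrightarrow> \<bar>D t\<bar> \<le> \<beta>"
    and Kbound: "\<And>t. t \<in> {0..b} \<Longrightarrow> \<bar>t * K t\<bar> \<le> \<kappa>"
  shows "\<bar>integral {0..b} (\<lambda>t. \<phi> t * K t)\<bar> \<le> \<kappa> * W + \<beta> * (B + W)"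
proof -
  define I where "I = integral {0..b} (\<lambda>t. \<bar>\<phi> t\<bar>)"
  have "0 \<le> L" using lip[of 0 b] b by (simp add: zero_le_mult_iff) (smt (verit) mult_neg_pos)
  have "0 \<le> \<beta>" using Dbound[of b] b by (smt (verit) atLeastAtMost_iff)
  have "0 \<le> B" using bound[of b] b by (smt (verit))
  have "continuous_on {0..b} K"
    by (rule lipschitz_on_continuous_on[of L])
       (use lip \<open>0 \<le> L\<close> in \<open>auto simp: lipschitz_on_def dist_real_def\<close>)
  have step: "\<bar>integral {0..b} (\<lambda>t. \<phi> t * K t)\<bar> \<le> \<kappa> * W + \<beta> * (B + W) + (L * b * I + L * b * b * B) / m"
    if "0 < m" for m :: nat
  proof -
    define h where "h = b / m"
    define t where "t i = real i * h" for i
    have h: "0 < h" "m * h = b" using b that by (auto simp: h_def)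
    have t: "t 0 = 0" "t m = b" "\<And>i. t (Suc i) = t i + h" 
      using h by (auto simp: t_def algebra_simps)
    have tb: "0 \<le> t i \<and> t i \<le> b" if "i \<le> m" for i
      using that h by (auto simp: t_def simp flip: h(2) intro!: mult_right_mono)
    have tpos: "0 < t (Suc i)" for i using h by (simp add: t_def)
    define R where "R = (\<Sum>i<m. K (t i) * (integral {0..t (Suc i)} \<phi> - integral {0..t i} \<phi>))"
    have riemann: "\<bar>integral {0..b} (\<lambda>t. \<phi> t * K t) - R\<bar> \<le> L * h * I"
      unfolding R_def I_def t(2)[symmetric]
    proof (rule riemann_sum_product_error[where b = b])
      fix i s assume "i < m" "t i \<le> s" "s \<le> t (Suc i)"
      then have "\<bar>K s - K (t i)\<bar> \<le> L * \<bar>s - t i\<bar>"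
        using tb[of i] tb[of "Suc i"] by (intro lip) auto
      also have "\<dots> \<le> L * h"
        using \<open>t i \<le> s\<close> \<open>s \<le> t (Suc i)\<close> t(3)[of i] \<open>0 \<le> L\<close> by (intro mult_left_mono) auto
      finally show "\<bar>K s - K (t i)\<bar> \<le> L * h" .
    qed (use int \<open>continuous_on {0..b} K\<close> t tb h in auto)
    \<comment> \<open>At \<open>t 0 = 0\<close> both sides vanish whatever \<open>q 0\<close> is.\<close>
    have mean': "integral {0..t i} \<phi> = t i * q (t i)" if "i \<le> m" for i
      using mean[of "t i"] tb[OF that] by (cases "t i = 0") auto
    have "integral {0..t (Suc i)} \<phi> - integral {0..t i} \<phi> = t i * (q (t (Suc i)) - q (t i)) + h * q (t (Suc i))"
      if "i < m" for i
      using mean'[of i] mean'[of "Suc i"] that by (simp add: t(3) algebra_simps)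
    note increment = this
    have R: "R = (\<Sum>i<m. t i * K (t i) * (q (t (Suc i)) - q (t i))) + (\<Sum>i<m. h * K (t i) * q (t (Suc i)))"
      unfolding R_def sum.distrib[symmetric] by (intro sum.cong) (auto simp: increment algebra_simps)
    have var: "(\<Sum>i=1..<m. \<bar>q (t (Suc i)) - q (t i)\<bar>) \<le> W"
      using variation[of m] by (simp add: t_def h_def)
    have weighted: "\<bar>\<Sum>i<m. g i * (q (t (Suc i)) - q (t i))\<bar> \<le> \<gamma> * W"
      if g: "\<And>i. i < m \<Longrightarrow> \<bar>g i\<bar> \<le> \<gamma>" and g0: "g 0 = 0" for g \<gamma>
    proof -
      have "0 \<le> \<gamma>" using g[of 0] g0 \<open>0 < m\<close> by simp
      have "(\<Sum>i<m. g i * (q (t (Suc i)) - q (t i))) = (\<Sum>i=1..<m. g i * (q (t (Suc i)) - q (t i)))"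
        by (intro sum.mono_neutral_right) (auto simp: g0 not_less_eq_eq intro: gr0I)
      also have "\<bar>\<dots>\<bar> \<le> (\<Sum>i=1..<m. \<bar>g i * (q (t (Suc i)) - q (t i))\<bar>)"
        by (rule sum_abs)
      also have "\<dots> \<le> (\<Sum>i=1..<m. \<gamma> * \<bar>q (t (Suc i)) - q (t i)\<bar>)"
        unfolding abs_mult using g by (intro sum_mono mult_right_mono) auto
      also have "\<dots> \<le> \<gamma> * W"
        using var \<open>0 \<le> \<gamma>\<close> by (simp add: mult_left_mono flip: sum_distrib_left)
      finally show ?thesis .
    qed
    have first: "\<bar>\<Sum>i<m. t i * K (t i) * (q (t (Suc i)) - q (t i))\<bar> \<le> \<kappa> * W"
      using tb Kbound t(1) by (intro weighted) auto
    have dsum: "\<bar>\<Sum>i<m. (D (t (Suc i)) - D (t i)) * q (t (Suc i))\<bar> \<le> \<beta> * (B + W)"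
    proof -
      have "(\<Sum>i<m. (D (t (Suc i)) - D (t i)) * q (t (Suc i)))
         = D (t m) * q (t m) - (\<Sum>i<m. D (t i) * (q (t (Suc i)) - q (t i)))"
        using sum_diff_times_by_parts[where D = "\<lambda>i. D (t i)" and m = m and q = "\<lambda>i. q (t i)"] D0 t(1) by simp
      moreover have "\<bar>D (t m) * q (t m)\<bar> \<le> \<beta> * B"
        unfolding abs_mult using Dbound[of b] bound[of b] b t(2) \<open>0 \<le> \<beta>\<close> by (intro mult_mono) auto
      moreover have "\<bar>\<Sum>i<m. D (t i) * (q (t (Suc i)) - q (t i))\<bar> \<le> \<beta> * W"
        using tb Dbound t(1) D0 by (intro weighted) auto
      ultimately show ?thesis by (simp add: distrib_left)
    qed
    have err: "\<bar>(\<Sum>i<m. h * K (t i) * q (t (Suc i))) - (\<Sum>i<m. (D (t (Suc i)) - D (t i)) * q (t (Suc i)))\<bar>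
       \<le> m * (L * h * h * B)"
    proof -
      have each: "\<bar>h * K (t i) * q (t (Suc i)) - (D (t (Suc i)) - D (t i)) * q (t (Suc i))\<bar> \<le> L * h * h * B"
        if "i < m" for i
      proof -
        obtain \<xi> where \<xi>: "t i < \<xi>" "\<xi> < t (Suc i)" "D (t (Suc i)) - D (t i) = (t (Suc i) - t i) * K \<xi>"
          using MVT2[of "t i" "t (Suc i)" D K] D t(3) h by auto
        have "\<bar>K (t i) - K \<xi>\<bar> \<le> L * \<bar>t i - \<xi>\<bar>"
          using \<xi> tb[of i] tb[of "Suc i"] that by (intro lip) auto
        also have "\<dots> \<le> L * h"
          using \<xi> t(3)[of i] \<open>0 \<le> L\<close> by (intro mult_left_mono) auto
        finally have *: "\<bar>K (t i) - K \<xi>\<bar> \<le> L * h" .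
        have "h * K (t i) * q (t (Suc i)) - (D (t (Suc i)) - D (t i)) * q (t (Suc i)) = (K (t i) - K \<xi>) * h * q (t (Suc i))"
          unfolding \<xi>(3) using t(3)[of i] by (simp add: left_diff_distrib)
        also have "\<bar>\<dots>\<bar> = \<bar>K (t i) - K \<xi>\<bar> * h * \<bar>q (t (Suc i))\<bar>"
          using h by (simp add: abs_mult)
        also have "\<dots> \<le> L * h * h * B"
          using * h \<open>0 \<le> L\<close> bound[of "t (Suc i)"] tb[of "Suc i"] tpos[of i] that
          by (intro mult_mono) auto
        finally show ?thesis .
      qed
      have "\<bar>\<Sum>i<m. h * K (t i) * q (t (Suc i)) - (D (t (Suc i)) - D (t i)) * q (t (Suc i))\<bar> \<le> (\<Sum>i<m. L * h * h * B)"
        by (rule order_trans[OF sum_abs sum_mono]) (use each in auto)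
      then show ?thesis by (simp add: sum_subtractf)
    qed
    have "\<bar>integral {0..b} (\<lambda>t. \<phi> t * K t)\<bar> \<le> \<kappa> * W + \<beta> * (B + W) + (L * h * I + m * (L * h * h * B))"
      using riemann first dsum err unfolding R by linarith
    also have "L * h * I + m * (L * h * h * B) = (L * b * I + L * b * b * B) / m"
      using that by (simp add: h_def field_simps)
    finally show ?thesis .
  qed
  have "(\<lambda>m. \<kappa> * W + \<beta> * (B + W) + (L * b * I + L * b * b * B) / real m) \<longlonglongrightarrow> \<kappa> * W + \<beta> * (B + W) + 0"
    by (intro tendsto_intros lim_const_over_n)
  then show ?thesis
    using step by (intro LIMSEQ_le_const[of _ _ "\<bar>integral {0..b} (\<lambda>t. \<phi> t * K t)\<bar>"]) (auto intro!: exI[of _ 1])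
qed

text \<open>A uniform partition of \<open>(0,b]\<close> contains the endpoint \<open>b\<close>, which lies outside the interval where
  the variation is bounded. The single increment ending there is estimated by the bound for \<open>\<bar>q\<bar>\<close>.\<close>

lemma bounded_variation_uniform_partition:
  assumes bv: "bounded_variation_on q {0<..<b}" and b: "0 < b"
  obtains B W where "\<And>t. 0 < t \<Longrightarrow> t \<le> b \<Longrightarrow> \<bar>q t\<bar> \<le> B"
    "\<And>m. (\<Sum>i=1..<m. \<bar>q (real (Suc i) * (b / m)) - q (real i * (b / m))\<bar>) \<le> W"
proof -
  obtain M where M: "\<And>(m::nat) t. (\<forall>i\<le>m. t i \<in> {0<..<b}) \<Longrightarrow> (\<forall>i<m. t i \<le> t (Suc i))
       \<Longrightarrow> (\<Sum>i<m. \<bar>q (t (Suc i)) - q (t i)\<bar>) \<le> M"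
    using bv unfolding bounded_variation_on_def by blast
  have pair: "\<bar>q s - q r\<bar> \<le> M" if "0 < r" "r \<le> s" "s < b" for r s
    using M[of 1 "\<lambda>i. if i = 0 then r else s"] that by auto
  have "0 \<le> M" using pair[of "b/2" "b/2"] b by simp
  define B where "B = \<bar>q (b / 2)\<bar> + \<bar>q b\<bar> + M"
  have B: "\<bar>q t\<bar> \<le> B" if "0 < t" "t \<le> b" for t
  proof (cases "t = b")
    case True
    then show ?thesis using \<open>0 \<le> M\<close> by (simp add: B_def)
  next
    case False
    then show ?thesis
      using that b pair[of t "b / 2"] pair[of "b / 2" t] unfolding B_def by linarith
  qed
  have "(\<Sum>i=1..<m. \<bar>q (real (Suc i) * (b / m)) - q (real i * (b / m))\<bar>) \<le> M + 2 * B" for m :: nat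
  proof (cases "m \<le> 1")
    case True
    then show ?thesis using \<open>0 \<le> M\<close> by (simp add: B_def)
  next
    case False
    then obtain n where n: "m = Suc (Suc n)"
      by (metis One_nat_def Suc_le_mono le0 not0_implies_Suc)
    define u where "u i = real (Suc i) * (b / m)" for i
    have u: "0 < u i" for i using b by (simp add: u_def n)
    have um: "u i \<le> u j" if "i \<le> j" for i j
      using that b unfolding u_def by (intro mult_right_mono) auto
    have un: "u i < b" if "i \<le> n" for i
    proof -
      have "u i \<le> u n" by (rule um[OF that])
      also have "u n < b" using b by (simp add: u_def n field_simps)
      finally show ?thesis .
    qed
    have ub: "u (Suc n) = b" by (simp add: u_def n)
    have "(\<Sum>i=1..<m. \<bar>q (real (Suc i) * (b / m)) - q (real i * (b / m))\<bar>) = (\<Sum>i<Suc n. \<bar>q (u (Suc i)) - q (u i)\<bar>)"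
      unfolding n lessThan_atLeast0
      by (simp only: One_nat_def sum.shift_bounds_Suc_ivl u_def n)
    also have "\<dots> = (\<Sum>i<n. \<bar>q (u (Suc i)) - q (u i)\<bar>) + \<bar>q b - q (u n)\<bar>"
      by (simp add: ub)
    also have "\<dots> \<le> M + (B + B)"
    proof (intro add_mono)
      show "(\<Sum>i<n. \<bar>q (u (Suc i)) - q (u i)\<bar>) \<le> M"
        using u un um by (intro M) auto
      show "\<bar>q b - q (u n)\<bar> \<le> B + B"
        using B[of b] B[of "u n"] b u[of n] un[of n] by auto
    qed
    finally show ?thesis by simp
  qed
  with B show thesis by (rule that)
qed

section \<open>Boundedness of the Cesaro means of the weighted Fourier terms\<close>

text \<open>Jordan's inequality: the concave function \<open>sin\<close> lies above its chord from 0 to \<open>\<pi>/2\<close>.\<close>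

lemma two_over_pi_le_sin:
  assumes "0 \<le> y" "y \<le> pi / 2"
  shows "2 / pi * y \<le> sin y"
proof -
  have "convex_on {0..pi} (\<lambda>y. - sin y)"
    by (rule f''_ge0_imp_convex[where f' = "\<lambda>y. - cos y" and f'' = sin])
      (auto intro!: derivative_eq_intros sin_ge_zero)
  from convex_onD[OF this, of "2 / pi * y" 0 "pi / 2"] assms show ?thesis
    by (simp add: field_simps)
qed

text \<open>Multiplication by \<open>2 * sin (t / 2)\<close> telescopes the sum, and \<open>sin (t / 2)\<close> is at least \<open>t / \<pi>\<close>.\<close>

lemma cosine_sum_bound:
  assumes "0 \<le> t" "t \<le> pi"
  shows "\<bar>t * (\<Sum>v=1..n. cos (real v * t))\<bar> \<le> pi"
proof -
  have tel: "2 * sin (t / 2) * (\<Sum>v=1..n. cos (real v * t)) = sin (n * t + t / 2) - sin (t / 2)"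
  proof (induction n)
    case (Suc n)
    have "2 * sin (t / 2) * cos (real (Suc n) * t) = sin (Suc n * t + t / 2) - sin (Suc n * t - t / 2)"
      by (simp add: sin_add sin_diff)
    also have "Suc n * t - t / 2 = n * t + t / 2" by (simp add: field_simps)
    finally show ?case using Suc by (simp add: distrib_left del: of_nat_Suc)
  qed simp
  have "t \<le> pi * sin (t / 2)"
    using two_over_pi_le_sin[of "t / 2"] assms by (simp add: field_simps)
  then have "t \<le> pi * \<bar>sin (t / 2)\<bar>"
    by (rule order_trans) (simp add: mult_left_mono)
  then have "2 * \<bar>t * (\<Sum>v=1..n. cos (real v * t))\<bar> \<le> pi * \<bar>2 * sin (t / 2) * (\<Sum>v=1..n. cos (real v * t))\<bar>"
    using assms mult_right_mono[of t "pi * \<bar>sin (t / 2)\<bar>" "\<bar>\<Sum>v=1..n. cos (real v * t)\<bar>"]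
    by (simp add: abs_mult mult_ac)
  also have "\<dots> \<le> pi * 2"
    unfolding tel 
    using abs_sin_le_one[of "n * t + t / 2"] abs_sin_le_one[of "t / 2"]
    by (intro mult_left_mono) (linarith, simp)
  finally show ?thesis by simp
qed

text \<open>Summation by parts expresses the kernel through \<open>2 * n\<close> unweighted cosine sums, counted with
  multiplicity.\<close>

lemma weighted_cosine_sum_bound:
  assumes "0 \<le> t" "t \<le> pi"
  shows "\<bar>t * (\<Sum>v=1..n. real v * cos (real v * t))\<bar> \<le> 2 * pi * n"
proof -
  define S where "S m = (\<Sum>v=1..m. cos (real v * t))" for m
  have "(\<Sum>v=1..n. real v * cos (real v * t)) = n * S n - (\<Sum>m<n. S m)"
    by (induction n) (simp_all add: S_def algebra_simps)
  then have "t * (\<Sum>v=1..n. real v * cos (real v * t)) = n * (t * S n) - (\<Sum>m<n. t * S m)"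
    by (simp add: right_diff_distrib sum_distrib_left)
  also have "\<bar>\<dots>\<bar> \<le> n * \<bar>t * S n\<bar> + (\<Sum>m<n. \<bar>t * S m\<bar>)"
    using sum_abs[of "\<lambda>m. t * S m" "{..<n}"] abs_triangle_ineq4[of "n * (t * S n)" "\<Sum>m<n. t * S m"]
    by (simp add: abs_mult)
  also have "\<dots> \<le> n * pi + (\<Sum>m<n. pi)"
    unfolding S_def by (intro add_mono mult_left_mono sum_mono cosine_sum_bound assms) auto
  finally show ?thesis by simp
qed

lemma cos_diff_le:
  fixes a c :: real
  shows "\<bar>cos a - cos c\<bar> \<le> \<bar>a - c\<bar>"
proof -
  have "norm (cos a - cos c) \<le> 1 * norm (a - c)"
    by (rule field_differentiable_bound[where S = UNIV and f' = "\<lambda>x. - sin x"])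
      (auto intro!: derivative_eq_intros)
  then show ?thesis by simp
qed

text \<open>The kernel \<open>K\<close>, its primitive \<open>D\<close> and the weighted kernel \<open>t * K t\<close> satisfy the hypotheses of
  \<open>integral_product_bound_of_mean_variation\<close> with \<open>\<beta> = n\<close> and \<open>\<kappa> = 2 * \<pi> * n\<close>, both linear in \<open>n\<close>.\<close>

theorem fourier_term_means_bounded:
  fixes f :: "real \<Rightarrow> real"
  assumes per: "\<And>t. f (t + 2 * pi) = f t"
    and int: "set_integrable lebesgue {-pi<..<pi} f"
    and bv: "bounded_variation_on (phi1 f x) {0<..<pi}"
  obtains M where "\<And>n. \<bar>\<Sum>v=1..n. real v * fourier_term f v x\<bar> \<le> M * real n"
proof -
  have fint: "f absolutely_integrable_on {a..b}" for a b
    using periodic_absolutely_integrable[of f "2 * pi" "-pi", OF per] int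
    by (simp add: absolutely_integrable_on_Icc_iff_Ioo)
  have \<phi>: "phi f x absolutely_integrable_on {a..b}" for a b
    by (rule phi_absolutely_integrable[OF fint])
  obtain B W where B: "\<And>t. 0 < t \<Longrightarrow> t \<le> pi \<Longrightarrow> \<bar>phi1 f x t\<bar> \<le> B"
    and W: "\<And>m. (\<Sum>i=1..<m. \<bar>phi1 f x (real (Suc i) * (pi / m)) - phi1 f x (real i * (pi / m))\<bar>) \<le> W"
    using bounded_variation_uniform_partition[OF bv pi_gt_zero] by blast
  have "\<bar>\<Sum>v=1..n. real v * fourier_term f v x\<bar> \<le> 2 / pi * (2 * pi * W + (B + W)) * real n" for n
  proof -
    define K where "K t = (\<Sum>v=1..n. real v * cos (real v * t))" for t
    define D where "D t = (\<Sum>v=1..n. sin (real v * t))" for t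
    have "\<bar>integral {0..pi} (\<lambda>t. phi f x t * K t)\<bar> \<le> (2 * pi * n) * W + n * (B + W)"
    proof (rule integral_product_bound_of_mean_variation[where q = "phi1 f x" and D = D and L = "\<Sum>v=1..n. real v * real v"])
      show "integral {0..t} (phi f x) = t * phi1 f x t" if "0 < t" for t
        using that by (simp add: phi1_def set_lebesgue_integral_eq_integral(2)[OF \<phi>])
      show "\<bar>K s - K t\<bar> \<le> (\<Sum>v=1..n. real v * real v) * \<bar>s - t\<bar>" for s t
      proof -
        have "K s - K t = (\<Sum>v=1..n. real v * (cos (real v * s) - cos (real v * t)))"
          by (simp add: K_def sum_subtractf right_diff_distrib)
        also have "\<bar>\<dots>\<bar> \<le> (\<Sum>v=1..n. \<bar>real v * (cos (real v * s) - cos (real v * t))\<bar>)"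
          by (rule sum_abs)
        also have "\<dots> \<le> (\<Sum>v=1..n. real v * real v * \<bar>s - t\<bar>)"
        proof (rule sum_mono)
          fix v
          have "real v * \<bar>cos (real v * s) - cos (real v * t)\<bar> \<le> real v * \<bar>real v * s - real v * t\<bar>"
            by (intro mult_left_mono cos_diff_le) simp
          also have "real v * s - real v * t = real v * (s - t)" by (simp add: right_diff_distrib)
          finally show "\<bar>real v * (cos (real v * s) - cos (real v * t))\<bar> \<le> real v * real v * \<bar>s - t\<bar>"
            by (simp add: abs_mult mult.assoc)
        qed
        finally show ?thesis by (simp add: sum_distrib_right)
      qed
      show "(D has_real_derivative K t) (at t)" for t
        unfolding D_def K_def
        by (auto intro!: derivative_eq_intros sum.cong simp: mult.commute)
      show "\<bar>D t\<bar> \<le> real n" for t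
        unfolding D_def by (rule order_trans[OF sum_abs order_trans[OF sum_mono[where g = "\<lambda>_. 1"]]]) auto
      show "\<bar>t * K t\<bar> \<le> 2 * pi * n" if "t \<in> {0..pi}" for t
        using weighted_cosine_sum_bound[of t n] that by (simp add: K_def)
    qed (use \<phi> B W in \<open>auto simp: D_def\<close>)
    moreover have "(\<Sum>v=1..n. real v * fourier_term f v x) = 2 / pi * integral {0..pi} (\<lambda>t. phi f x t * K t)"
    proof -
      have "(\<lambda>t. phi f x t * cos (real v * t)) integrable_on {0..pi}" for v
        using absolutely_integrable_mult_continuous[OF \<phi>[of 0 pi], of "\<lambda>t. cos (real v * t)"]
        unfolding absolutely_integrable_on_def by (force intro!: continuous_intros)
      then have "integral {0..pi} (\<lambda>t. \<Sum>v=1..n. real v * (phi f x t * cos (real v * t)))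
        = (\<Sum>v=1..n. real v * integral {0..pi} (\<lambda>t. phi f x t * cos (real v * t)))"
        by (subst integral_sum) (auto intro!: integrable_on_mult_right)
      moreover have "(\<Sum>v=1..n. real v * (phi f x t * cos (real v * t))) = phi f x t * K t" for t
        by (simp add: K_def sum_distrib_left mult_ac)
      ultimately show ?thesis
        by (simp add: fourier_term_eq_cosine_integral[OF per fint] sum_distrib_left mult_ac)
    qed
    ultimately show ?thesis
      by (simp add: abs_mult field_simps)
  qed
  then show thesis by (rule that)
qed

section \<open>The factors and the summability theorem\<close>

text \<open>Each \<open>\<bar>lam v\<bar>\<close> is bounded by the tail sum of \<open>A\<close> from \<open>v\<close> on, and interchanging the summations collects
  the partial sums of the weights \<open>w\<close>. The tail is first cut at a finite \<open>M\<close>; the remainder disappears as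
  \<open>M\<close> grows because \<open>lam\<close> tends to 0.\<close>

lemma weighted_sum_le_of_differences:
  fixes lam A w :: "nat \<Rightarrow> real"
  assumes lim: "lam \<longlonglongrightarrow> 0"
    and diff: "\<And>n. 1 \<le> n \<Longrightarrow> \<bar>lam n - lam (Suc n)\<bar> \<le> A n"
    and w: "\<And>n. 0 \<le> w n"
    and S: "\<And>M. (\<Sum>u=1..M. A u * (\<Sum>v=1..u. w v)) \<le> S"
  shows "(\<Sum>v=1..N. w v * \<bar>lam v\<bar>) \<le> S"
proof -
  have A: "0 \<le> A n" if "1 \<le> n" for n using diff[OF that] by linarith
  have tail: "\<bar>lam v\<bar> \<le> (\<Sum>u=v..M. A u) + \<bar>lam (Suc M)\<bar>" if "v \<le> M" "1 \<le> v" for v M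
    using that(1)
  proof (induction M rule: dec_induct)
    case base
    then show ?case using diff[OF that(2)] by simp
  next
    case (step M)
    then show ?case using diff[of "Suc M"] by simp
  qed
  have "(\<Sum>v=1..N. w v * \<bar>lam v\<bar>) \<le> S + (\<Sum>v=1..N. w v) * \<bar>lam (Suc M)\<bar>" if "N \<le> M" for M
  proof -
    have "(\<Sum>v=1..N. w v * \<bar>lam v\<bar>) \<le> (\<Sum>v=1..N. w v * ((\<Sum>u=v..M. A u) + \<bar>lam (Suc M)\<bar>))"
      using that w tail by (intro sum_mono mult_left_mono) auto
    also have "\<dots> = (\<Sum>v=1..N. w v * (\<Sum>u=v..M. A u)) + (\<Sum>v=1..N. w v) * \<bar>lam (Suc M)\<bar>"
      by (simp add: distrib_left sum.distrib sum_distrib_right)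
    also have "(\<Sum>v=1..N. w v * (\<Sum>u=v..M. A u)) \<le> (\<Sum>v=1..M. w v * (\<Sum>u=v..M. A u))"
      using that w A by (intro sum_mono2 mult_nonneg_nonneg sum_nonneg) auto
    also have "\<dots> = (\<Sum>v\<in>{1..M}. \<Sum>u\<in>{u\<in>{1..M}. v \<le> u}. w v * A u)"
      unfolding sum_distrib_left by (intro sum.cong refl) auto
    also have "\<dots> = (\<Sum>u\<in>{1..M}. \<Sum>v\<in>{v\<in>{1..M}. v \<le> u}. w v * A u)"
      by (rule sum.swap_restrict) auto
    also have "\<dots> = (\<Sum>u=1..M. A u * (\<Sum>v=1..u. w v))"
      unfolding sum_distrib_left by (intro sum.cong refl) auto
    also have "\<dots> \<le> S" by (rule S)
    finally show ?thesis by simp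
  qed
  moreover have "(\<lambda>M. S + (\<Sum>v=1..N. w v) * \<bar>lam (Suc M)\<bar>) \<longlonglongrightarrow> S + (\<Sum>v=1..N. w v) * \<bar>0\<bar>"
    by (intro tendsto_intros LIMSEQ_Suc lim)
  ultimately show ?thesis
    by (intro LIMSEQ_le_const[of _ "S" "\<Sum>v=1..N. w v * \<bar>lam v\<bar>"]) auto
qed

text \<open>Positivity of \<open>g\<close> lets a larger constant absorb the finitely many exceptional indices.\<close>

lemma bigo_sequence_bound:
  fixes f g :: "nat \<Rightarrow> real"
  assumes "f \<in> O(g)" and pos: "\<And>n. 0 < g n"
  obtains C where "0 \<le> C" "\<And>n. f n \<le> C * g n"
proof -
  obtain c where c: "\<forall>\<^sub>F n in sequentially. norm (f n) \<le> c * norm (g n)"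
    using assms(1) by (elim landau_o.bigE)
  then obtain N where N: "\<And>n. N \<le> n \<Longrightarrow> \<bar>f n\<bar> \<le> c * \<bar>g n\<bar>"
    unfolding eventually_sequentially real_norm_def by blast
  define C where "C = \<bar>c\<bar> + (\<Sum>i<N. \<bar>f i / g i\<bar>)"
  have S: "0 \<le> (\<Sum>i<N. \<bar>f i / g i\<bar>)" by (rule sum_nonneg) simp
  have "f n \<le> C * g n" for n
  proof (cases "N \<le> n")
    case True
    have "f n \<le> c * g n" using N[OF True] pos[of n] by simp
    also have "\<dots> \<le> C * g n" using S pos[of n] unfolding C_def by (intro mult_right_mono) auto
    finally show ?thesis .
  next
    case False
    then have "\<bar>f n / g n\<bar> \<le> (\<Sum>i<N. \<bar>f i / g i\<bar>)"
      by (intro member_le_sum) auto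
    then have "f n / g n \<le> C" unfolding C_def by linarith
    then show ?thesis using pos[of n] by (simp add: field_simps)
  qed
  moreover have "0 \<le> C" using S by (simp add: C_def)
  ultimately show thesis using that by blast
qed

theorem theorem2p1:
  fixes k x :: real
    and f :: "real \<Rightarrow> real"
    and p lam \<delta> A :: "nat \<Rightarrow> real"
    and a :: "nat \<Rightarrow> nat \<Rightarrow> real"
  assumes k: "k \<ge> 1"
    and f_periodic: "\<And>t. f (t + 2 * pi) = f t"
    and f_integrable: "set_integrable lebesgue {-pi<..<pi} f"
    and f_zero_mean: "(LINT t:{-pi..pi}|lebesgue. f t) = 0"
    and phi1_bv: "bounded_variation_on (phi1 f x) {0<..<pi}"
    and p_pos: "\<And>n. p n > 0"
    and P_infinity: "filterlim (P_sum p) at_top sequentially"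
    and P_bigo: "P_sum p \<in> O(\<lambda>n. real n * p n)"
    and lam_tendsto: "lam \<longlonglongrightarrow> 0"
    and delta_pos: "\<And>n. n \<ge> 1 \<Longrightarrow> \<delta> n > 0"
    and A_quasi_monotone: "quasi_monotone \<delta> A"
    and delta_summable: "summable (\<lambda>n. real n * X_sum p n * \<delta> n)"
    and AX_summable: "summable (\<lambda>n. A n * X_sum p n)"
    and lam_diff: "\<And>n. n \<ge> 1 \<Longrightarrow> \<bar>lam n - lam (Suc n)\<bar> \<le> \<bar>A n\<bar>"
    and a_normal: "normal_matrix a"
    and a_positive: "positive_matrix a"
    and cond_i: "\<And>n. bar_mat a n 0 = 1"
    and cond_ii: "\<And>n v. n \<ge> v + 1 \<Longrightarrow> a (n - 1) v \<ge> a n v"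
    and cond_iii: "(\<lambda>n. a n n) \<in> O(\<lambda>n. p n / P_sum p n)"
    and cond_iv: "\<exists>K. \<forall>n v. 1 \<le> v \<and> v \<le> n - 1 \<longrightarrow>
      \<bar>hat_mat a n (v + 1)\<bar> \<le> K * (real v * \<bar>bar_Delta a n v\<bar>)"
  shows "abs_summable_matrix a p k (\<lambda>n. fourier_term f n x * lam n)"
proof -
  define w where "w n = p n / P_sum p n" for n
  have P_pos: "0 < P_sum p n" for n
    unfolding P_sum_def using p_pos by (intro sum_pos) auto
  have w_pos: "0 < w n" for n using p_pos P_pos by (simp add: w_def)
  have X_mono: "X_sum p m \<le> X_sum p n" if "m \<le> n" for m n
    using that w_pos unfolding X_sum_def w_def by (intro sum_mono2) (auto simp: less_imp_le)
  have X_pos: "0 < X_sum p 1" using w_pos[of 1] by (simp add: X_sum_def w_def)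
  have X_nonneg: "0 \<le> X_sum p n" for n
    using X_mono[of 0 n] by (simp add: X_sum_def)

  \<comment> \<open>Ultimate positivity of \<open>A\<close> upgrades convergence to absolute convergence.\<close>
  have AX: "summable (\<lambda>n. \<bar>A n\<bar> * X_sum p n)"
  proof (rule summable_comparison_test_ev[OF _ AX_summable])
    have "\<forall>\<^sub>F n in sequentially. 0 < A n"
      using A_quasi_monotone by (simp add: quasi_monotone_def)
    then show "\<forall>\<^sub>F n in sequentially. norm (\<bar>A n\<bar> * X_sum p n) \<le> A n * X_sum p n"
      by eventually_elim (simp add: X_nonneg)
  qed
  define S where "S = (\<Sum>n. \<bar>A n\<bar> * X_sum p n)"
  have S: "(\<Sum>u=1..M. \<bar>A u\<bar> * X_sum p u) \<le> S" for M
    unfolding S_def using AX X_nonneg by (intro sum_le_suminf) auto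
  have wlam: "(\<Sum>v=1..N. w v * \<bar>lam v\<bar>) \<le> S" for N
    using lam_tendsto lam_diff S less_imp_le[OF w_pos]
    by (intro weighted_sum_le_of_differences[of lam "\<lambda>n. \<bar>A n\<bar>"]) (auto simp: X_sum_def w_def)

  \<comment> \<open>\<open>X_sum\<close> is bounded away from 0 for \<open>n \<ge> 1\<close>.\<close>
  have "summable (\<lambda>n. \<bar>A n\<bar>)"
  proof (rule summable_comparison_test_ev)
    show "summable (\<lambda>n. \<bar>A n\<bar> * X_sum p n / X_sum p 1)"
      by (intro summable_divide AX)
    show "\<forall>\<^sub>F n in sequentially. norm \<bar>A n\<bar> \<le> \<bar>A n\<bar> * X_sum p n / X_sum p 1"
      using eventually_ge_at_top[of 1]
    proof eventually_elim
      case (elim n)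
      have "\<bar>A n\<bar> * X_sum p 1 \<le> \<bar>A n\<bar> * X_sum p n"
        by (intro mult_left_mono X_mono elim) simp
      then show ?case using X_pos by (simp add: field_simps)
    qed
  qed
  then have sum_diff: "summable (\<lambda>n. \<bar>lam n - lam (Suc n)\<bar>)"
    by (rule summable_comparison_test_ev[rotated])
      (use lam_diff in \<open>auto intro: eventually_mono[OF eventually_ge_at_top[of 1]]\<close>)

  obtain C where C: "0 \<le> C" "\<And>n. a n n \<le> C * w n"
    using bigo_sequence_bound[OF cond_iii] w_pos unfolding w_def by blast
  obtain c where c: "\<forall>\<^sub>F n in sequentially. norm (P_sum p n) \<le> c * norm (real n * p n)" "0 < c"
    using P_bigo by (elim landau_o.bigE) 
  \<comment> \<open>By \<open>P_bigo\<close>, \<open>1 / n\<close> is ultimately at most \<open>c * w n\<close>.\<close>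
  have "summable (\<lambda>n. c * (w (Suc n) * \<bar>lam (Suc n)\<bar>))"
  proof (intro summable_mult summableI_nonneg_bounded)
    show "(\<Sum>n<N. w (Suc n) * \<bar>lam (Suc n)\<bar>) \<le> S" for N
      using wlam[of N] sum.atLeast1_atMost_eq[of "\<lambda>v. w v * \<bar>lam v\<bar>" N] by simp
  qed (use w_pos in \<open>simp add: less_imp_le\<close>)
  then have "summable (\<lambda>n. \<bar>lam (Suc n)\<bar> / real (Suc n))"
  proof (rule summable_comparison_test_ev[rotated])
    have "\<forall>\<^sub>F n in sequentially. norm (P_sum p (Suc n)) \<le> c * norm (real (Suc n) * p (Suc n))"
      using c(1) by (subst eventually_sequentially_Suc)
    then show "\<forall>\<^sub>F n in sequentially. norm (\<bar>lam (Suc n)\<bar> / real (Suc n)) \<le> c * (w (Suc n) * \<bar>lam (Suc n)\<bar>)"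
    proof eventually_elim
      case (elim n)
      have "P_sum p (Suc n) \<le> c * (real (Suc n) * p (Suc n))"
        using elim P_pos[of "Suc n"] p_pos[of "Suc n"] by (simp add: abs_mult)
      then have "1 / real (Suc n) \<le> c * w (Suc n)"
        using P_pos[of "Suc n"] by (simp add: w_def field_simps)
      then have "1 / real (Suc n) * \<bar>lam (Suc n)\<bar> \<le> c * w (Suc n) * \<bar>lam (Suc n)\<bar>"
        by (rule mult_right_mono) simp
      then show ?case by (simp add: mult.assoc)
    qed
  qed
  with sum_diff have sum_both: "summable (\<lambda>n. \<bar>lam n - lam (Suc n)\<bar> + \<bar>lam (Suc n)\<bar> / real (Suc n))"
    by (rule summable_add)

  obtain L where L: "\<And>n. \<bar>lam n\<bar> \<le> L"
    using Bseq_def convergent_imp_Bseq[OF convergentI[OF lam_tendsto]] by (metis real_norm_def)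
  obtain M where M: "\<And>n. \<bar>\<Sum>v=1..n. real v * fourier_term f v x\<bar> \<le> M * real n"
    using fourier_term_means_bounded[OF f_periodic f_integrable phi1_bv] by blast

  show ?thesis
  proof (rule abs_summable_matrix_of_bounded_means[where C = C and L = L and M = M])
    show "(\<Sum>v=1..N. a v v * \<bar>lam v\<bar>) \<le> C * S" for N
    proof -
      have "(\<Sum>v=1..N. a v v * \<bar>lam v\<bar>) \<le> (\<Sum>v=1..N. C * w v * \<bar>lam v\<bar>)"
        by (intro sum_mono mult_right_mono C) auto
      also have "\<dots> = C * (\<Sum>v=1..N. w v * \<bar>lam v\<bar>)"
        by (simp add: sum_distrib_left mult.assoc)
      also have "\<dots> \<le> C * S" by (intro mult_left_mono wlam C)
      finally show ?thesis .
    qed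
    show "(\<Sum>v=1..<N. \<bar>lam v - lam (Suc v)\<bar> + \<bar>lam (Suc v)\<bar> / Suc v)
        \<le> (\<Sum>n. \<bar>lam n - lam (Suc n)\<bar> + \<bar>lam (Suc n)\<bar> / real (Suc n))" for N
      using sum_both by (intro sum_le_suminf) auto
  qed (use k p_pos cond_i cond_ii C M L a_normal a_positive in
      \<open>auto simp: w_def normal_matrix_def positive_matrix_def\<close>)
qed

end
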